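(* For any modal formula $A$, the following are equivalent: (1) $\mathbf{NR}\vdash A$; (2) $A$ is valid in all serial $\mathbf{N}$-frames; (3) $A$ is valid in all finite serial $\mathbf{N}$-frames; (4) $A$ is valid in all finite $\mathrm{Sub}(A)$-serial $\mathbf{N}$-frames.
   Context: Modal formulas are built from propositional variables and $\bot$ using $\neg,\land,\lor,\to$ and $\Box$; $\mathrm{Sub}(A)$ is the set of subformulas of $A$. $\mathbf{N}$ has all propositional tautologies as axioms and Modus Ponens and Necessitation $A/\Box A$ as rules; $\mathbf{NR}$ is $\mathbf{N}$ plus the rule $\neg B/\neg\Box B$. An $\mathbf{N}$-frame is $(W, \{\prec_B\}_B)$ with $W$ nonempty and a binary relation $\prec_B$ on $W$ for each modal formula $B$ (finite if $W$ is finite); an $\mathbf{N}$-model adds $\Vdash$ with usual propositional clauses and $x\Vdash\Box B$ iff $y\Vdash B$ for all $y$ with $x\prec_B y$. Validity in a frame means truth at all worlds of all models on the frame. The frame is $B$-serial if every $x$ has some $y$ with $x\prec_B y$; it is $\Gamma$-serial for a set $\Gamma$ of formulas if it is $B$-serial for every $B$ with $\Box B\in\Gamma$; it is serial if it is $B$-serial for all $B$. *)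

theory Defs
  imports "HOL-Library.Infinite_Typeclass"
begin

datatype 'p fm =
    Var 'p
  | Bot
  | Neg "'p fm"
  | Conj "'p fm" "'p fm"
  | Disj "'p fm" "'p fm"
  | Imp "'p fm" "'p fm"
  | Box "'p fm"

fun Sub :: "'p fm \<Rightarrow> 'p fm set" where
  "Sub (Var p) = {Var p}"
| "Sub Bot = {Bot}"
| "Sub (Neg B) = insert (Neg B) (Sub B)"
| "Sub (Conj B C) = insert (Conj B C) (Sub B \<union> Sub C)"
| "Sub (Disj B C) = insert (Disj B C) (Sub B \<union> Sub C)"
| "Sub (Imp B C) = insert (Imp B C) (Sub B \<union> Sub C)"
| "Sub (Box B) = insert (Box B) (Sub B)"

text \<open>Truth-table evaluation of modal formulas, in which the variables and the formulas
  \<open>Box B\<close> are the atoms: \<open>v\<close> assigns truth values to the former, \<open>b\<close> to the latter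
  (as a function of \<open>B\<close>).\<close>

fun peval :: "('p \<Rightarrow> bool) \<Rightarrow> ('p fm \<Rightarrow> bool) \<Rightarrow> 'p fm \<Rightarrow> bool" where
  "peval v b (Var p) \<longleftrightarrow> v p"
| "peval v b Bot \<longleftrightarrow> False"
| "peval v b (Neg B) \<longleftrightarrow> \<not> peval v b B"
| "peval v b (Conj B C) \<longleftrightarrow> peval v b B \<and> peval v b C"
| "peval v b (Disj B C) \<longleftrightarrow> peval v b B \<or> peval v b C"
| "peval v b (Imp B C) \<longleftrightarrow> (peval v b B \<longrightarrow> peval v b C)"
| "peval v b (Box B) \<longleftrightarrow> b B"

definition tautology :: "'p fm \<Rightarrow> bool" where
  "tautology A \<longleftrightarrow> (\<forall>v b. peval v b A)"

inductive NR_provable :: "'p fm \<Rightarrow> bool" where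
  Taut: "tautology A \<Longrightarrow> NR_provable A"
| MP: "NR_provable A \<Longrightarrow> NR_provable (Imp A B) \<Longrightarrow> NR_provable B"
| Nec: "NR_provable A \<Longrightarrow> NR_provable (Box A)"
| Ros: "NR_provable (Neg B) \<Longrightarrow> NR_provable (Neg (Box B))"

text \<open>Worlds are drawn from a type \<open>'w\<close>. Statements about all frames leave \<open>'w\<close> an arbitrary
  infinite type: every finite frame has an isomorphic copy inside any such type, and every
  frame lives inside some such type.\<close>

locale N_frame =
  fixes W :: "'w set" and R :: "'p fm \<Rightarrow> ('w \<times> 'w) set"
  assumes nonempty: "W \<noteq> {}"
    and rel_on: "R B \<subseteq> W \<times> W"

text \<open>The forcing relation \<open>S\<close> is arbitrary on variables, and irrelevant outside \<open>W\<close>.\<close>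

locale N_model = N_frame W R
  for W :: "'w set" and R :: "'p fm \<Rightarrow> ('w \<times> 'w) set" +
  fixes S :: "'w \<Rightarrow> 'p fm \<Rightarrow> bool"
  assumes forces_Bot: "x \<in> W \<Longrightarrow> \<not> S x Bot"
    and forces_Neg: "x \<in> W \<Longrightarrow> S x (Neg B) \<longleftrightarrow> \<not> S x B"
    and forces_Conj: "x \<in> W \<Longrightarrow> S x (Conj B C) \<longleftrightarrow> S x B \<and> S x C"
    and forces_Disj: "x \<in> W \<Longrightarrow> S x (Disj B C) \<longleftrightarrow> S x B \<or> S x C"
    and forces_Imp: "x \<in> W \<Longrightarrow> S x (Imp B C) \<longleftrightarrow> (S x B \<longrightarrow> S x C)"
    and forces_Box: "x \<in> W \<Longrightarrow> S x (Box B) \<longleftrightarrow> (\<forall>y. (x, y) \<in> R B \<longrightarrow> S y B)"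

definition valid_in :: "'w set \<Rightarrow> ('p fm \<Rightarrow> ('w \<times> 'w) set) \<Rightarrow> 'p fm \<Rightarrow> bool" where
  "valid_in W R A \<longleftrightarrow> (\<forall>S. N_model W R S \<longrightarrow> (\<forall>x\<in>W. S x A))"

definition fm_serial :: "'w set \<Rightarrow> ('p fm \<Rightarrow> ('w \<times> 'w) set) \<Rightarrow> 'p fm \<Rightarrow> bool" where
  "fm_serial W R B \<longleftrightarrow> (\<forall>x\<in>W. \<exists>y\<in>W. (x, y) \<in> R B)"

definition set_serial :: "'w set \<Rightarrow> ('p fm \<Rightarrow> ('w \<times> 'w) set) \<Rightarrow> 'p fm set \<Rightarrow> bool" where
  "set_serial W R \<Gamma> \<longleftrightarrow> (\<forall>B. Box B \<in> \<Gamma> \<longrightarrow> fm_serial W R B)"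

definition serial :: "'w set \<Rightarrow> ('p fm \<Rightarrow> ('w \<times> 'w) set) \<Rightarrow> bool" where
  "serial W R \<longleftrightarrow> (\<forall>B. fm_serial W R B)"

end

theory Submission
  imports Defs
begin

text \<open>
  Soundness for serial frames is immediate. It extends to \<open>Sub A\<close>-serial frames because the
  relations of boxed formulas outside \<open>Sub A\<close> can be replaced by the total relation without
  affecting the truth of \<open>A\<close>.

  For completeness, call a truth assignment admissible if, for all \<open>Box B \<in> Sub A\<close>, it makes
  \<open>Box B\<close> true when \<open>B\<close> is provable and false when \<open>Neg B\<close> is. Only finitely many theorems are
  involved, so a formula true under all admissible assignments is provable. The worlds are the
  traces of admissible assignments on \<open>Sub A\<close>, where \<open>X\<close> sees \<open>Y\<close> via \<open>B\<close> iff \<open>Box B \<in> X\<close> implies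
  \<open>B \<in> Y\<close>. Unprovability of \<open>Neg B\<close> yields seriality, unprovability of \<open>B\<close> the truth lemma, and
  unprovability of \<open>A\<close> a world refuting it.
\<close>

section \<open>Subformulas, forcing and soundness\<close>

lemma Sub_refl [simp]: "A \<in> Sub A"
  by (cases A) auto

lemma Sub_trans: "B \<in> Sub A \<Longrightarrow> C \<in> Sub B \<Longrightarrow> C \<in> Sub A"
  by (induction A) auto

lemma finite_Sub [simp]: "finite (Sub A)"
  by (induction A) auto

text \<open>\<open>N_model\<close> only axiomatizes its relation \<open>S\<close>; this recursion
  builds such a relation on any frame from a valuation of the variables.\<close>

fun forces :: "('p fm \<Rightarrow> ('w \<times> 'w) set) \<Rightarrow> ('w \<Rightarrow> 'p \<Rightarrow> bool) \<Rightarrow> 'w \<Rightarrow> 'p fm \<Rightarrow> bool" where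
  "forces R V x (Var p) \<longleftrightarrow> V x p"
| "forces R V x Bot \<longleftrightarrow> False"
| "forces R V x (Neg B) \<longleftrightarrow> \<not> forces R V x B"
| "forces R V x (Conj B C) \<longleftrightarrow> forces R V x B \<and> forces R V x C"
| "forces R V x (Disj B C) \<longleftrightarrow> forces R V x B \<or> forces R V x C"
| "forces R V x (Imp B C) \<longleftrightarrow> (forces R V x B \<longrightarrow> forces R V x C)"
| "forces R V x (Box B) \<longleftrightarrow> (\<forall>y. (x, y) \<in> R B \<longrightarrow> forces R V y B)"

lemma N_model_forces: "N_frame W R \<Longrightarrow> N_model W R (forces R V)"
  by (simp add: N_model_def N_model_axioms_def)

lemma (in N_model) forces_eq_peval:
  "x \<in> W \<Longrightarrow> S x A \<longleftrightarrow> peval (\<lambda>p. S x (Var p)) (\<lambda>B. S x (Box B)) A"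
  by (induction A)
    (simp_all add: forces_Bot forces_Neg forces_Conj forces_Disj forces_Imp)

lemma (in N_model) NR_sound_model:
  assumes "NR_provable A" and "serial W R" and "x \<in> W"
  shows "S x A"
  using assms(1,3)
proof (induction arbitrary: x)
  case (Taut A)
  then show ?case
    using forces_eq_peval[of x A] unfolding tautology_def by blast
next
  case (MP A B)
  then show ?case
    using forces_Imp by blast
next
  case (Nec A)
  then show ?case
    using forces_Box rel_on by blast
next
  case (Ros B)
  \<comment> \<open>Seriality enters only here: a successor refuting \<open>B\<close> refutes
    \<open>Box B\<close> at \<open>x\<close>.\<close>
  obtain y where "y \<in> W" "(x, y) \<in> R B"
    using \<open>serial W R\<close> Ros.prems unfolding serial_def fm_serial_def by blast
  then show ?case
    using Ros forces_Box forces_Neg by blast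
qed

lemma NR_sound: "NR_provable A \<Longrightarrow> serial W R \<Longrightarrow> valid_in W R A"
  unfolding valid_in_def by (intro allI impI ballI) (rule N_model.NR_sound_model)

text \<open>Evaluating a subformula of \<open>A\<close> only ever consults the relations of boxed
  subformulas of \<open>A\<close>.\<close>

lemma (in N_model) forces_cong_Sub:
  assumes "\<And>B. Box B \<in> Sub A \<Longrightarrow> R' B = R B"
    and "C \<in> Sub A" and "x \<in> W"
  shows "forces R' (\<lambda>x p. S x (Var p)) x C \<longleftrightarrow> S x C"
  using assms(2,3)
proof (induction C arbitrary: x)
  case (Box B)
  have "B \<in> Sub A"
    using Sub_trans[OF Box.prems(1)] by simp
  moreover have "R' B = R B"
    using Box.prems(1) assms(1) by blast
  moreover have "y \<in> W" if "(x, y) \<in> R B" for y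
    using rel_on that by blast
  ultimately show ?case
    using Box.IH forces_Box[OF Box.prems(2)] by simp
next
  case (Neg B)
  then have "B \<in> Sub A" using Sub_trans[OF Neg.prems(1)] by simp
  with Neg show ?case by (simp add: forces_Neg)
next
  case (Conj B C)
  have "B \<in> Sub A" "C \<in> Sub A" using Sub_trans[OF Conj.prems(1)] by simp_all
  with Conj show ?case by (simp add: forces_Conj)
next
  case (Disj B C)
  have "B \<in> Sub A" "C \<in> Sub A" using Sub_trans[OF Disj.prems(1)] by simp_all
  with Disj show ?case by (simp add: forces_Disj)
next
  case (Imp B C)
  have "B \<in> Sub A" "C \<in> Sub A" using Sub_trans[OF Imp.prems(1)] by simp_all
  with Imp show ?case by (simp add: forces_Imp)
qed (simp_all add: forces_Bot)

text \<open>A derivation of \<open>A\<close> may apply \<open>Ros\<close> to formulas outside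
  \<open>Sub A\<close>, so the frame is first made fully serial without changing the truth of
  \<open>A\<close>.\<close>

lemma NR_sound_Sub_serial:
  assumes "NR_provable A" and "set_serial W R (Sub A)"
  shows "valid_in W R A"
  unfolding valid_in_def
proof (intro allI impI ballI)
  fix S x
  assume model: "N_model W R S" and "x \<in> W"
  interpret N_model W R S by (fact model)
  define R' where "R' B = (if Box B \<in> Sub A then R B else W \<times> W)" for B
  have "N_frame W R'"
    using nonempty rel_on by (auto simp: N_frame_def R'_def)
  then have "N_model W R' (forces R' (\<lambda>x p. S x (Var p)))"
    by (rule N_model_forces)
  moreover have "serial W R'"
    using assms(2) nonempty
    by (auto simp: serial_def set_serial_def fm_serial_def R'_def)
  ultimately have "forces R' (\<lambda>x p. S x (Var p)) x A"
    using \<open>x \<in> W\<close> by (rule N_model.NR_sound_model[OF _ assms(1)])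
  then show "S x A"
    using forces_cong_Sub[of A R' A x] \<open>x \<in> W\<close> by (simp add: R'_def)
qed

section \<open>Provability from finitely many admissibility conditions\<close>

lemma NR_tautological_consequence:
  assumes "finite \<Gamma>" and "\<And>C. C \<in> \<Gamma> \<Longrightarrow> NR_provable C"
    and "\<And>v b. (\<And>C. C \<in> \<Gamma> \<Longrightarrow> peval v b C) \<Longrightarrow> peval v b D"
  shows "NR_provable D"
  using assms
proof (induction \<Gamma> arbitrary: D rule: finite_induct)
  case empty
  then show ?case
    by (simp add: NR_provable.Taut tautology_def)
next
  case (insert C \<Gamma>)
  \<comment> \<open>The premise \<open>C\<close> moves into the goal, which leaves a consequence of
    the smaller set.\<close>
  have "NR_provable (Imp C D)"
  proof (rule insert.IH)
    show "NR_provable E" if "E \<in> \<Gamma>" for E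
      using insert.prems(1) that by simp
    show "peval v b (Imp C D)" if "\<And>E. E \<in> \<Gamma> \<Longrightarrow> peval v b E" for v b
      using insert.prems(2)[of v b] that by auto
  qed
  then show ?case
    using NR_provable.MP insert.prems(1) by blast
qed

definition admissible :: "'p fm \<Rightarrow> ('p fm \<Rightarrow> bool) \<Rightarrow> bool" where
  "admissible A b \<longleftrightarrow> (\<forall>B. Box B \<in> Sub A \<longrightarrow>
     (NR_provable B \<longrightarrow> b B) \<and> (NR_provable (Neg B) \<longrightarrow> \<not> b B))"

lemma admissible_complete:
  assumes "\<And>v b. admissible A b \<Longrightarrow> peval v b C"
  shows "NR_provable C"
proof (rule NR_tautological_consequence)
  \<comment> \<open>By \<open>Nec\<close> and \<open>Ros\<close>, this finite set of theorems
    contains every literal \<open>Box B\<close> or \<open>Neg (Box B)\<close> that admissibility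
    demands.\<close>
  let ?\<Gamma> = "{D \<in> Sub A \<union> Neg ` Sub A. (\<exists>B. D = Box B \<or> D = Neg (Box B)) \<and> NR_provable D}"
  show "finite ?\<Gamma>" by simp
  show "NR_provable D" if "D \<in> ?\<Gamma>" for D using that by simp
  show "peval v b C" if true: "\<And>D. D \<in> ?\<Gamma> \<Longrightarrow> peval v b D" for v b
  proof (rule assms, unfold admissible_def, intro allI impI conjI)
    fix B assume "Box B \<in> Sub A"
    then show "b B" if "NR_provable B"
      using true[of "Box B"] that by (simp add: NR_provable.Nec)
    show "\<not> b B" if "NR_provable (Neg B)"
      using true[of "Neg (Box B)"] that \<open>Box B \<in> Sub A\<close> by (simp add: NR_provable.Ros)
  qed
qed

section \<open>Finite canonical worlds and the countermodel\<close>

definition trace :: "'p fm \<Rightarrow> ('p \<Rightarrow> bool) \<Rightarrow> ('p fm \<Rightarrow> bool) \<Rightarrow> 'p fm set" where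
  "trace A v b = {C \<in> Sub A. peval v b C}"

definition worlds :: "'p fm \<Rightarrow> 'p fm set set" where
  "worlds A = {trace A v b | v b. admissible A b}"

lemma finite_worlds: "finite (worlds A)"
  by (rule finite_subset[of _ "Pow (Sub A)"]) (auto simp: worlds_def trace_def)

lemma ex_world_notin:
  assumes "\<not> NR_provable C" and "C \<in> Sub A"
  shows "\<exists>X\<in>worlds A. C \<notin> X"
proof -
  obtain v b where "admissible A b" "\<not> peval v b C"
    using admissible_complete assms(1) by blast
  then show ?thesis
    by (auto simp: worlds_def trace_def)
qed

text \<open>Here \<open>admissible_complete\<close> is applied to \<open>Neg C\<close>, which may
  lie outside \<open>Sub A\<close>.\<close>

lemma ex_world_in:
  assumes "\<not> NR_provable (Neg C)" and "C \<in> Sub A"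
  shows "\<exists>X\<in>worlds A. C \<in> X"
proof -
  obtain v b where "admissible A b" "\<not> peval v b (Neg C)"
    using admissible_complete assms(1) by blast
  then show ?thesis
    using assms(2) by (auto simp: worlds_def trace_def)
qed

lemma world_Box:
  assumes "X \<in> worlds A" and "Box B \<in> Sub A"
  shows "NR_provable B \<Longrightarrow> Box B \<in> X" and "NR_provable (Neg B) \<Longrightarrow> Box B \<notin> X"
  using assms by (auto simp: worlds_def trace_def admissible_def)

lemma NR_countermodel:
  fixes A :: "'p fm"
  assumes "\<not> NR_provable A"
  shows "\<exists>(W :: 'w::infinite set) R. N_frame W R \<and> finite W \<and> serial W R \<and> \<not> valid_in W R A"
proof -
  \<comment> \<open>Worlds are sets of formulas, so a copy of them is placed inside the infinite
    type \<open>'w\<close>, with \<open>g\<close> decoding its points.\<close>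
  obtain W :: "'w set" where "finite W" "card W = card (worlds A)"
    using infinite_arbitrarily_large[OF infinite_UNIV] by blast
  then obtain g where g: "bij_betw g W (worlds A)"
    using finite_same_card_bij finite_worlds by blast
  have g_world: "g x \<in> worlds A" if "x \<in> W" for x
    using g that by (auto simp: bij_betw_def)
  have g_surj: "\<exists>x\<in>W. g x = X" if "X \<in> worlds A" for X
    using bij_betw_imp_surj_on[OF g] that by (metis imageE)
  \<comment> \<open>Outside \<open>Sub A\<close> the relation is total, which gives seriality for
    all formulas.\<close>
  define R where
    "R B = {(x, y) \<in> W \<times> W. Box B \<in> Sub A \<longrightarrow> Box B \<in> g x \<longrightarrow> B \<in> g y}" for B
  let ?S = "forces R (\<lambda>x p. Var p \<in> g x)"
  obtain x0 where x0: "x0 \<in> W" "A \<notin> g x0"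
    using ex_world_notin[OF assms Sub_refl] g_surj by metis
  have frame: "N_frame W R"
    using x0 by (auto simp: N_frame_def R_def)
  have "\<exists>y\<in>W. (x, y) \<in> R B" if "x \<in> W" for x B
  proof (cases "Box B \<in> Sub A \<and> Box B \<in> g x")
    case True
    then have "\<not> NR_provable (Neg B)" "B \<in> Sub A"
      using world_Box(2)[OF g_world[OF that]] Sub_trans[of "Box B" A B] by auto
    then obtain y where "y \<in> W" "B \<in> g y"
      using ex_world_in g_surj by metis
    then show ?thesis
      using that by (auto simp: R_def)
  next
    \<comment> \<open>Now \<open>x\<close> sees every point, itself included.\<close>
    case False
    then show ?thesis
      using that by (auto simp: R_def)
  qed
  then have "serial W R"
    by (simp add: serial_def fm_serial_def)
  have truth: "?S x C \<longleftrightarrow> C \<in> g x" if "C \<in> Sub A" "x \<in> W" for x C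
    using that
  proof (induction C arbitrary: x)
    case (Box B)
    have B: "B \<in> Sub A"
      using Sub_trans[OF Box.prems(1)] by simp
    \<comment> \<open>If \<open>Box B\<close> is missing from \<open>g x\<close>, then
      \<open>x\<close> sees all points, in particular one that omits the unprovable
      \<open>B\<close>.\<close>
    have "\<exists>y. (x, y) \<in> R B \<and> B \<notin> g y" if "Box B \<notin> g x"
    proof -
      have "\<not> NR_provable B"
        using world_Box(1) g_world[OF Box.prems(2)] Box.prems(1) that by blast
      then obtain y where "y \<in> W" "B \<notin> g y"
        using ex_world_notin[OF _ B] g_surj by metis
      then show ?thesis
        using that Box.prems(2) by (auto simp: R_def)
    qed
    moreover have "y \<in> W" if "(x, y) \<in> R B" for y
      using that by (simp add: R_def)
    moreover have "B \<in> g y" if "Box B \<in> g x" "(x, y) \<in> R B" for y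
      using that Box.prems(1) by (simp add: R_def)
    ultimately show ?case
      using Box.IH[OF B] by (simp only: forces.simps) blast
  next
    case (Neg B)
    have "B \<in> Sub A" using Sub_trans[OF Neg.prems(1)] by simp
    with Neg g_world[OF Neg.prems(2)] show ?case by (auto simp: worlds_def trace_def)
  next
    case (Conj B C)
    have "B \<in> Sub A" "C \<in> Sub A" using Sub_trans[OF Conj.prems(1)] by simp_all
    with Conj g_world[OF Conj.prems(2)] show ?case by (auto simp: worlds_def trace_def)
  next
    case (Disj B C)
    have "B \<in> Sub A" "C \<in> Sub A" using Sub_trans[OF Disj.prems(1)] by simp_all
    with Disj g_world[OF Disj.prems(2)] show ?case by (auto simp: worlds_def trace_def)
  next
    case (Imp B C)
    have "B \<in> Sub A" "C \<in> Sub A" using Sub_trans[OF Imp.prems(1)] by simp_all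
    with Imp g_world[OF Imp.prems(2)] show ?case by (auto simp: worlds_def trace_def)
  next
    case Bot
    with g_world[OF Bot.prems(2)] show ?case by (auto simp: worlds_def trace_def)
  qed simp
  have "\<not> ?S x0 A"
    using truth x0 by simp
  then have "\<not> valid_in W R A"
    using N_model_forces[OF frame] x0(1) unfolding valid_in_def by blast
  with frame \<open>finite W\<close> \<open>serial W R\<close> show ?thesis
    by blast
qed

theorem theorem3p12:
  fixes A :: "'p fm"
  shows "(NR_provable A \<longleftrightarrow>
            (\<forall>(W :: 'w::infinite set) R. N_frame W R \<and> serial W R \<longrightarrow> valid_in W R A))
       \<and> (NR_provable A \<longleftrightarrow>
            (\<forall>(W :: 'w set) R. N_frame W R \<and> finite W \<and> serial W R \<longrightarrow> valid_in W R A))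
       \<and> (NR_provable A \<longleftrightarrow>
            (\<forall>(W :: 'w set) R. N_frame W R \<and> finite W \<and> set_serial W R (Sub A) \<longrightarrow> valid_in W R A))"
    (is "(_ \<longleftrightarrow> ?serial) \<and> (_ \<longleftrightarrow> ?fin_serial) \<and> (_ \<longleftrightarrow> ?fin_Sub_serial)")
proof (cases "NR_provable A")
  case True
  then show ?thesis
    by (simp add: NR_sound NR_sound_Sub_serial)
next
  case False
  \<comment> \<open>One finite serial countermodel refutes all three validity conditions.\<close>
  obtain W :: "'w set" and R
    where W: "N_frame W R" "finite W" "serial W R" "\<not> valid_in W R A"
    using NR_countermodel[OF False] by (elim exE conjE)
  then have "set_serial W R (Sub A)"
    by (simp add: serial_def set_serial_def)
  with W have "\<not> ?serial" "\<not> ?fin_serial" "\<not> ?fin_Sub_serial"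
    by blast+
  with False show ?thesis
    by simp
qed

end
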